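(* Let $0<q<1$ and let $\eta,\kappa,\sigma,c,\rho,s,x\in\mathbb{C}$ with $\Re(\eta)>0$, $\Re(\kappa)>0$, $\Re(\rho)>0$, $\Re(s)>0$, $\Re(c)>\Re(\sigma)>0$ and $|x s^{-\rho}|<(1-q)^{-\Re(\eta)}$. Then the $q$-Laplace transform of the function $u\mapsto E_{\eta,\kappa}^{(\sigma;c)}(xu^\rho;q)$ is $${}_qL_s\left[E_{\eta,\kappa}^{(\sigma;c)}(xu^\rho;q)\right]=\frac1s\sum_{m=0}^\infty\frac{B_q(\sigma+m,c-\sigma)\,(q^{c};q)_m}{B_q(\sigma,c-\sigma)\,(q;q)_m}\,\frac{\Gamma_q(1+\rho m)}{\Gamma_q(\eta m+\kappa)}\left(\frac{(1-q)^\rho x}{s^\rho}\right)^m .$$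
   Context: Let $0<q<1$. For $\lambda\in\mathbb{C}$, $(\lambda;q)_0=1$, $(\lambda;q)_m=\prod_{i=0}^{m-1}(1-\lambda q^i)$ for $m\ge1$, and $(\lambda;q)_\infty=\prod_{i\ge0}(1-\lambda q^i)$. Complex powers are principal values. The $q$-gamma function is $\Gamma_q(z)=\frac{(q;q)_\infty}{(q^z;q)_\infty}(1-q)^{1-z}$; at its poles $1/\Gamma_q(z)$ is read as $0$. The $q$-beta function is $B_q(a,b)=\frac{\Gamma_q(a)\Gamma_q(b)}{\Gamma_q(a+b)}$ for $\Re(a),\Re(b)>0$. For $\Re(c)>\Re(\sigma)>0$ the extended $q$-Mittag-Leffler function is $$E_{\eta,\kappa}^{(\sigma;c)}(u;q)=\sum_{m=0}^\infty\frac{B_q(\sigma+m,c-\sigma)}{B_q(\sigma,c-\sigma)}\,\frac{(q^{c};q)_m}{(q;q)_m}\,\frac{u^m}{\Gamma_q(\eta m+\kappa)}.$$ The $q$-Laplace transform of a function $f$ is $${}_qL_s\{f(u)\}=\frac{1}{1-q}\int_0^{s^{-1}}(qsu;q)_\infty f(u)\,d_qu=\frac{(q;q)_\infty}{s}\sum_{j=0}^\infty\frac{q^j f(s^{-1}q^j)}{(q;q)_j},$$ where $\int_0^a g(u)\,d_qu=a(1-q)\sum_{k=0}^\infty q^kg(aq^k)$. *)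

theory Defs
  imports "HOL-Analysis.Analysis"
begin

definition qpoch :: "real \<Rightarrow> complex \<Rightarrow> nat \<Rightarrow> complex" where
  "qpoch q a m = (\<Prod>i<m. 1 - a * of_real q ^ i)"

definition qpoch_inf :: "real \<Rightarrow> complex \<Rightarrow> complex" where
  "qpoch_inf q a = (\<Prod>i. 1 - a * of_real q ^ i)"

text \<open>
  The poles of \<open>q_Gamma q\<close> are the zeros of the denominator. There the definition gives
  the value 0, because division by 0 yields 0, and so \<open>1 / q_Gamma q z = 0\<close> as usual.
\<close>
definition q_Gamma :: "real \<Rightarrow> complex \<Rightarrow> complex" where
  "q_Gamma q z =
     qpoch_inf q (of_real q) / qpoch_inf q (of_real q powr z) * of_real (1 - q) powr (1 - z)"

definition q_Beta :: "real \<Rightarrow> complex \<Rightarrow> complex \<Rightarrow> complex" where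
  "q_Beta q a b = q_Gamma q a * q_Gamma q b / q_Gamma q (a + b)"

definition q_mittag_leffler_term ::
    "real \<Rightarrow> complex \<Rightarrow> complex \<Rightarrow> complex \<Rightarrow> complex \<Rightarrow> complex \<Rightarrow> nat \<Rightarrow> complex" where
  "q_mittag_leffler_term q \<eta> \<kappa> \<sigma> c u m =
     q_Beta q (\<sigma> + of_nat m) (c - \<sigma>) / q_Beta q \<sigma> (c - \<sigma>)
     * (qpoch q (of_real q powr c) m / qpoch q (of_real q) m)
     * (u ^ m / q_Gamma q (\<eta> * of_nat m + \<kappa>))"

definition q_mittag_leffler ::
    "real \<Rightarrow> complex \<Rightarrow> complex \<Rightarrow> complex \<Rightarrow> complex \<Rightarrow> complex \<Rightarrow> complex" where
  "q_mittag_leffler q \<eta> \<kappa> \<sigma> c u = (\<Sum>m. q_mittag_leffler_term q \<eta> \<kappa> \<sigma> c u m)"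

text \<open>
  The Jackson integral of \<open>g\<close> from 0 to \<open>a\<close>. The endpoint may be complex; only the values
  of \<open>g\<close> at the points \<open>a * q ^ k\<close> enter.
\<close>
definition jackson_integrable :: "real \<Rightarrow> complex \<Rightarrow> (complex \<Rightarrow> complex) \<Rightarrow> bool" where
  "jackson_integrable q a g \<longleftrightarrow> summable (\<lambda>k. of_real q ^ k * g (a * of_real q ^ k))"

definition jackson_integral :: "real \<Rightarrow> complex \<Rightarrow> (complex \<Rightarrow> complex) \<Rightarrow> complex" where
  "jackson_integral q a g =
     a * of_real (1 - q) * (\<Sum>k. of_real q ^ k * g (a * of_real q ^ k))"

definition q_laplace_converges :: "real \<Rightarrow> complex \<Rightarrow> (complex \<Rightarrow> complex) \<Rightarrow> bool" where
  "q_laplace_converges q s f \<longleftrightarrow>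
     jackson_integrable q (inverse s) (\<lambda>u. qpoch_inf q (of_real q * s * u) * f u)"

definition q_laplace :: "real \<Rightarrow> complex \<Rightarrow> (complex \<Rightarrow> complex) \<Rightarrow> complex" where
  "q_laplace q s f =
     1 / of_real (1 - q)
     * jackson_integral q (inverse s) (\<lambda>u. qpoch_inf q (of_real q * s * u) * f u)"

lemma convergent_prod_qpoch:
  assumes "0 < q" "q < 1"
  shows "convergent_prod (\<lambda>i. 1 - a * of_real q ^ i :: complex)"
proof -
  have "summable (\<lambda>i. norm a * q ^ i)"
    using assms by (intro summable_mult summable_geometric) auto
  hence "abs_convergent_prod (\<lambda>i. 1 - a * of_real q ^ i :: complex)"
    using assms by (intro summable_imp_abs_convergent_prod) (simp add: norm_mult norm_power)
  thus ?thesis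
    by (rule abs_convergent_prod_imp_convergent_prod)
qed

lemma qpoch_nonzero:
  assumes "0 < q" "q < 1"
  shows "qpoch q (of_real q) m \<noteq> 0"
proof -
  have "1 - of_real q * of_real q ^ i \<noteq> (0 :: complex)" for i
  proof -
    have "q ^ Suc i < 1"
      using assms by (intro power_Suc_less_one) auto
    hence "complex_of_real (1 - q ^ Suc i) \<noteq> 0"
      by (subst of_real_eq_0_iff) linarith
    thus ?thesis by simp
  qed
  thus ?thesis by (simp add: qpoch_def)
qed

lemma qpoch_inf_shift:
  assumes "0 < q" "q < 1"
  shows "qpoch_inf q (of_real q) = qpoch q (of_real q) k * qpoch_inf q (of_real q ^ Suc k)"
proof -
  have nz: "1 - of_real q * of_real q ^ i \<noteq> (0 :: complex)" for i
    using qpoch_nonzero[OF assms, of "Suc i"] by (simp add: qpoch_def)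
  show ?thesis
    unfolding qpoch_inf_def qpoch_def
    using prodinf_split_initial_segment[OF convergent_prod_qpoch[OF assms], of k "of_real q"] nz
    by (simp add: power_add mult_ac)
qed

text \<open>The series form of the transform, and of its convergence condition.\<close>

lemma
  assumes "0 < q" "q < 1" "s \<noteq> 0"
  shows q_laplace_converges_iff:
    "q_laplace_converges q s f \<longleftrightarrow>
       summable (\<lambda>j. of_real q ^ j * f (inverse s * of_real q ^ j) / qpoch q (of_real q) j)"
    and q_laplace_eq_suminf: "q_laplace_converges q s f \<Longrightarrow>
       q_laplace q s f = qpoch_inf q (of_real q) / s *
         (\<Sum>j. of_real q ^ j * f (inverse s * of_real q ^ j) / qpoch q (of_real q) j)"
proof -
  let ?g = "\<lambda>j. of_real q ^ j * f (inverse s * of_real q ^ j) / qpoch q (of_real q) j"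
  have nz: "qpoch_inf q (of_real q) \<noteq> 0"
  proof -
    have "1 - of_real q * of_real q ^ i \<noteq> (0 :: complex)" for i
      using qpoch_nonzero[OF assms(1,2), of "Suc i"] by (simp add: qpoch_def)
    thus ?thesis
      unfolding qpoch_inf_def by (intro prodinf_nonzero convergent_prod_qpoch assms) auto
  qed
  have "qpoch_inf q (of_real q * s * (inverse s * of_real q ^ j))
      = qpoch_inf q (of_real q) / qpoch q (of_real q) j" for j
    using qpoch_inf_shift[OF assms(1,2), of j] qpoch_nonzero[OF assms(1,2), of j] assms(3)
    by (simp add: field_simps)
  hence eq: "(\<lambda>j. of_real q ^ j * (qpoch_inf q (of_real q * s * (inverse s * of_real q ^ j))
          * f (inverse s * of_real q ^ j)))
      = (\<lambda>j. qpoch_inf q (of_real q) * ?g j)"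
    by (auto simp: fun_eq_iff)
  show iff: "q_laplace_converges q s f \<longleftrightarrow> summable ?g"
    unfolding q_laplace_converges_def jackson_integrable_def eq
    using nz by (subst summable_cmult_iff) simp
  assume "q_laplace_converges q s f"
  hence "summable ?g" using iff by simp
  moreover have "complex_of_real (1 - q) \<noteq> 0"
    using assms(2) by (subst of_real_eq_0_iff) linarith
  ultimately show "q_laplace q s f = qpoch_inf q (of_real q) / s * (\<Sum>j. ?g j)"
    unfolding q_laplace_def jackson_integral_def eq
    by (subst suminf_mult) (simp_all add: divide_inverse mult_ac del: of_real_diff)
qed

end

theory Submission
  imports Defs
begin

text \<open>
  The transform is a double series: the inner sum is the power series of the Mittag-Leffler
  function at the point \<open>x * (q^j / s) powr \<rho>\<close>, the outer sum runs over the nodes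
  \<open>q^j / s\<close> of the Jackson integral with weights \<open>q^j / (q;q)_j\<close>. Since \<open>q^j > 0\<close> and
  \<open>Re s > 0\<close>, the principal power splits as \<open>s powr (-\<rho>) * (q powr \<rho>)^j\<close>, and so the
  part of the double series that depends on \<open>j\<close> is \<open>(q powr (1 + \<rho> m))^j / (q;q)_j\<close>.
  Once the order of summation is exchanged, Euler's identity
  \<open>\<Sum>j. z^j / (q;q)_j = 1 / (z;q)_\<infinity>\<close> (lemma \<open>euler_q_exponential\<close>) evaluates the sum
  over \<open>j\<close>. What it gives is \<open>q_Gamma q (1 + \<rho> m)\<close>, up to the factors \<open>(q;q)_\<infinity>\<close> and
  \<open>(1 - q) powr (\<rho> m)\<close>. Lemma \<open>q_laplace_powr_series\<close> carries this out for any
  coefficient sequence whose series converges absolutely at \<open>u = 1 / s\<close>; at the other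
  nodes the terms are smaller still, because \<open>Re \<rho> > 0\<close>.

  Absolute convergence at \<open>1 / s\<close> is where the bound on \<open>x\<close> is used. By the functional
  equation of the \<open>q\<close>-gamma function, the beta quotient times \<open>(q^c;q)_m / (q;q)_m\<close> is
  \<open>(q^\<sigma>;q)_m / (q;q)_m\<close>, which converges as \<open>m \<rightarrow> \<infinity>\<close> and hence is bounded. The reciprocal
  \<open>q\<close>-gamma factor is a bounded infinite product times \<open>(1 - q) powr (\<eta> m + \<kappa> - 1)\<close>. Thus
  the coefficients are \<open>O(((1 - q) powr Re \<eta>)^m)\<close> (lemma
  \<open>q_mittag_leffler_coefficient_bound\<close>), and the hypothesis on \<open>x\<close> gives a geometric
  majorant.
\<close>

section \<open>\<open>q\<close>-Pochhammer symbols\<close>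

lemma qpoch_tendsto_qpoch_inf:
  assumes "0 < q" "q < 1"
  shows "qpoch q a \<longlonglongrightarrow> qpoch_inf q a"
proof -
  have "(\<lambda>n. \<Prod>i\<le>n. 1 - a * of_real q ^ i) \<longlonglongrightarrow> qpoch_inf q a"
    unfolding qpoch_inf_def by (intro convergent_prod_LIMSEQ convergent_prod_qpoch assms)
  hence "(\<lambda>n. qpoch q a (Suc n)) \<longlonglongrightarrow> qpoch_inf q a"
    by (simp add: qpoch_def lessThan_Suc_atMost)
  thus ?thesis by (subst (asm) filterlim_sequentially_Suc)
qed

lemma qpoch_factor_nonzero:
  assumes "0 < q" "q < 1" "norm a < 1"
  shows "1 - a * of_real q ^ i \<noteq> (0 :: complex)"
proof
  assume "1 - a * of_real q ^ i = 0"
  hence "norm (a * of_real q ^ i) = 1" by (metis norm_one right_minus_eq)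
  moreover have "norm a * q ^ i \<le> norm a * 1"
    using assms by (intro mult_left_mono power_le_one) auto
  ultimately show False
    using assms by (simp add: norm_mult norm_power)
qed

lemma qpoch_inf_nonzero:
  assumes "0 < q" "q < 1" "norm a < 1"
  shows "qpoch_inf q a \<noteq> 0"
  unfolding qpoch_inf_def
  using assms by (intro prodinf_nonzero convergent_prod_qpoch qpoch_factor_nonzero)

lemma qpoch_inf_split:
  assumes "0 < q" "q < 1" "norm a < 1"
  shows "qpoch_inf q a = qpoch q a m * qpoch_inf q (a * of_real q ^ m)"
  unfolding qpoch_inf_def qpoch_def
  using prodinf_split_initial_segment[OF convergent_prod_qpoch[OF assms(1,2)], of m a]
    qpoch_factor_nonzero[OF assms]
  by (simp add: power_add mult_ac)

text \<open>
  On the closed unit disc each factor is at most \<open>1 + q^i \<le> exp (q^i)\<close>, which turns the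
  product into a geometric series.
\<close>
lemma norm_qpoch_inf_le:
  assumes "0 < q" "q < 1" "norm a \<le> 1"
  shows "norm (qpoch_inf q a) \<le> exp (1 / (1 - q))"
proof (rule tendsto_upperbound[OF tendsto_norm[OF qpoch_tendsto_qpoch_inf[OF assms(1,2)]]])
  have "norm (qpoch q a n) \<le> exp (1 / (1 - q))" for n
  proof -
    have "norm (1 - a * of_real q ^ i) \<le> exp (q ^ i)" for i
    proof -
      have "norm (1 - a * of_real q ^ i) \<le> 1 + norm a * q ^ i"
        using norm_triangle_ineq4[of 1 "a * of_real q ^ i"] assms
        by (simp add: norm_mult norm_power)
      also have "\<dots> \<le> 1 + 1 * q ^ i"
        using assms by (intro add_left_mono mult_right_mono) auto
      also have "\<dots> \<le> exp (q ^ i)" using exp_ge_add_one_self[of "q ^ i"] by simp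
      finally show ?thesis .
    qed
    hence "norm (qpoch q a n) \<le> (\<Prod>i<n. exp (q ^ i))"
      unfolding qpoch_def prod_norm[symmetric] by (intro prod_mono) auto
    also have "\<dots> = exp (\<Sum>i<n. q ^ i)" by (simp add: exp_sum)
    also have "(\<Sum>i<n. q ^ i) \<le> (\<Sum>i. q ^ i)"
      using assms by (intro sum_le_suminf summable_geometric) auto
    also have "(\<Sum>i. q ^ i) = 1 / (1 - q)"
      using assms by (intro suminf_geometric) auto
    finally show ?thesis by simp
  qed
  thus "\<forall>\<^sub>F n in sequentially. norm (qpoch q a n) \<le> exp (1 / (1 - q))" by simp
qed simp

lemma qpoch_quotient_bounded:
  assumes "0 < q" "q < 1"
  obtains C where "C > 0" "\<And>m. norm (qpoch q a m / qpoch q (of_real q) m) \<le> C"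
proof -
  have "(\<lambda>m. qpoch q a m / qpoch q (of_real q) m)
          \<longlonglongrightarrow> qpoch_inf q a / qpoch_inf q (of_real q)"
    using assms by (intro tendsto_divide qpoch_tendsto_qpoch_inf qpoch_inf_nonzero) auto
  hence "Bseq (\<lambda>m. qpoch q a m / qpoch q (of_real q) m)"
    using convergentI convergent_imp_Bseq by blast
  thus ?thesis using that by (auto elim!: BseqE)
qed

text \<open>
  The series \<open>F\<close> satisfies \<open>F (z q) = (1 - z) F z\<close>, because \<open>1 - q^(j+1)\<close> is the last
  factor of \<open>(q;q)_(j+1)\<close>. Iteration gives \<open>F (z q^n) = (z;q)_n F z\<close>, and the left side
  tends to \<open>F 0 = 1\<close>.
\<close>
lemma euler_q_exponential:
  assumes q: "0 < q" "q < 1" and z: "norm z < 1"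
  shows "(\<lambda>j. z ^ j / qpoch q (of_real q) j) sums (1 / qpoch_inf q z)"
proof -
  define b :: "nat \<Rightarrow> complex" where "b = (\<lambda>j. 1 / qpoch q (of_real q) j)"
  define F where "F = (\<lambda>w. \<Sum>j. b j * w ^ j)"
  \<comment> \<open>the numerator \<open>(0;q)_j\<close> is 1\<close>
  obtain C where C: "C > 0" "\<And>j. norm (b j) \<le> C"
    using qpoch_quotient_bounded[OF q, of 0] by (auto simp: b_def qpoch_def)
  have summ: "summable (\<lambda>j. b j * w ^ j)" if "norm w < 1" for w
  proof (rule summable_comparison_test)
    show "\<exists>N. \<forall>j\<ge>N. norm (b j * w ^ j) \<le> C * norm w ^ j"
      using C by (auto simp: norm_mult norm_power intro!: mult_right_mono)
    show "summable (\<lambda>j. C * norm w ^ j)"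
      using that by (intro summable_mult summable_geometric) auto
  qed
  have norm_q_power: "norm (of_real q ^ n :: complex) \<le> 1" for n
    using q by (simp add: norm_power power_le_one)
  have shrink: "norm (w * of_real q ^ n) < 1" if "norm w < 1" for w :: complex and n
    using mult_left_mono[OF norm_q_power[of n], of "norm w"] that by (simp add: norm_mult)
  have step: "F (w * of_real q) = (1 - w) * F w" if w: "norm w < 1" for w
  proof -
    have wq: "norm (w * of_real q) < 1" using shrink[OF w, of 1] by simp
    have rec: "b (Suc j) * (1 - of_real q ^ Suc j) = b j" for j
      using qpoch_nonzero[OF q, of "Suc j"] by (simp add: b_def qpoch_def divide_simps)
    have "F w - F (w * of_real q) = (\<Sum>j. b j * w ^ j - b j * (w * of_real q) ^ j)"
      unfolding F_def by (intro suminf_diff summ w wq)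
    also have "\<dots> = (\<Sum>j. b (Suc j) * w ^ Suc j - b (Suc j) * (w * of_real q) ^ Suc j)"
      using suminf_split_head[OF summable_diff[OF summ[OF w] summ[OF wq]]] by simp
    also have "\<dots> = (\<Sum>j. w * (b j * w ^ j))"
    proof (rule suminf_cong)
      fix j
      have "b (Suc j) * w ^ Suc j - b (Suc j) * (w * of_real q) ^ Suc j
          = (b (Suc j) * (1 - of_real q ^ Suc j)) * w ^ Suc j"
        by (simp add: power_mult_distrib algebra_simps)
      thus "b (Suc j) * w ^ Suc j - b (Suc j) * (w * of_real q) ^ Suc j = w * (b j * w ^ j)"
        unfolding rec by simp
    qed
    also have "\<dots> = w * F w" unfolding F_def by (intro suminf_mult summ w)
    finally show ?thesis by (simp add: algebra_simps)
  qed
  have iterate: "F (z * of_real q ^ n) = qpoch q z n * F z" for n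
  proof (induction n)
    case (Suc n)
    have "F (z * of_real q ^ Suc n) = (1 - z * of_real q ^ n) * F (z * of_real q ^ n)"
      using step[OF shrink[OF z, of n]] by (simp add: mult_ac)
    thus ?case using Suc by (simp add: qpoch_def mult_ac)
  qed (simp add: qpoch_def)
  have "isCont F 0"
    unfolding F_def by (rule isCont_powser[of _ "1 / 2"], rule summ) (auto simp: norm_divide)
  moreover have "(\<lambda>n. z * of_real q ^ n) \<longlonglongrightarrow> 0"
    using q by (intro tendsto_mult_right_zero LIMSEQ_power_zero) auto
  ultimately have "(\<lambda>n. F (z * of_real q ^ n)) \<longlonglongrightarrow> F 0"
    by (rule isCont_tendsto_compose)
  moreover have "F 0 = 1" unfolding F_def by (subst powser_zero) (simp add: b_def qpoch_def)
  moreover have "(\<lambda>n. F (z * of_real q ^ n)) \<longlonglongrightarrow> qpoch_inf q z * F z"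
    unfolding iterate by (intro tendsto_mult tendsto_const qpoch_tendsto_qpoch_inf q)
  ultimately have "qpoch_inf q z * F z = 1" by (metis LIMSEQ_unique)
  hence "F z = 1 / qpoch_inf q z"
    by (metis mult_zero_left nonzero_mult_div_cancel_left zero_neq_one)
  thus ?thesis
    using summable_sums[OF summ[OF z]] by (simp add: F_def b_def)
qed

section \<open>Complex powers and the \<open>q\<close>-gamma function\<close>

lemma powr_mult_of_nat:
  fixes z a :: complex
  assumes "z \<noteq> 0"
  shows "z powr (a * of_nat m) = (z powr a) ^ m"
  using assms by (simp add: powr_def exp_of_nat_mult[symmetric] mult_ac)

lemma norm_of_real_powr:
  assumes "0 < q"
  shows "norm (of_real q powr z :: complex) = q powr Re z"
  using assms by (subst norm_powr_real_powr) auto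

lemma norm_of_real_powr_less_1:
  assumes "0 < q" "q < 1" "Re z > 0"
  shows "norm (of_real q powr z :: complex) < 1"
  using assms by (simp add: norm_of_real_powr powr01_less_one)

text \<open>
  In the right half-plane the principal argument of \<open>inverse s\<close> is minus that of \<open>s\<close>, and a
  positive factor does not change it. Hence no branch correction appears.
\<close>
lemma powr_jackson_node:
  assumes "0 < q" "Re s > 0"
  shows "(inverse s * of_real q ^ j) powr \<rho> = s powr (- \<rho>) * (of_real q powr \<rho>) ^ j"
proof -
  have s: "s \<noteq> 0" "s \<notin> \<real>\<^sub>\<le>\<^sub>0"
    using assms by (auto simp: complex_nonpos_Reals_iff)
  have "Ln (of_real (q ^ j) * inverse s) = of_real (ln (q ^ j)) + Ln (inverse s)"
    using assms s Ln_times_of_real[of "q ^ j" "inverse s"] Ln_of_real[of "q ^ j"]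
    by (simp del: of_real_power)
  also have "of_real (ln (q ^ j)) = of_nat j * Ln (of_real q)"
    using assms by (simp add: ln_realpow Ln_of_real)
  also have "Ln (inverse s) = - Ln s"
    using s by (intro Ln_inverse)
  finally have "Ln (inverse s * of_real q ^ j) = of_nat j * Ln (of_real q) - Ln s"
    by (simp add: mult.commute)
  hence "(inverse s * of_real q ^ j) powr \<rho> = exp (\<rho> * (of_nat j * Ln (of_real q) - Ln s))"
    using assms s by (simp add: powr_def)
  thus ?thesis
    using assms s
    by (simp add: powr_def exp_of_nat_mult[symmetric] exp_add[symmetric] algebra_simps)
qed

lemma inverse_q_Gamma:
  assumes "0 < q" "q < 1"
  shows "inverse (q_Gamma q z) =
    qpoch_inf q (of_real q powr z) / qpoch_inf q (of_real q) * of_real (1 - q) powr (z - 1)"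
  using powr_minus[of "of_real (1 - q) :: complex" "1 - z"]
  by (simp add: q_Gamma_def field_simps)

lemma q_Gamma_nonzero:
  assumes "0 < q" "q < 1" "Re z > 0"
  shows "q_Gamma q z \<noteq> 0"
proof -
  have "complex_of_real (1 - q) \<noteq> 0" using assms by (subst of_real_eq_0_iff) linarith
  thus ?thesis
    using assms by (simp add: q_Gamma_def qpoch_inf_nonzero norm_of_real_powr_less_1)
qed

lemma q_Gamma_add_of_nat:
  assumes "0 < q" "q < 1" "Re z > 0"
  shows "q_Gamma q (z + of_nat m)
    = q_Gamma q z * qpoch q (of_real q powr z) m / of_real (1 - q) ^ m"
proof -
  define w :: complex where "w = of_real q powr z"
  define p :: complex where "p = of_real (1 - q)"
  have p: "p \<noteq> 0" using assms unfolding p_def by (subst of_real_eq_0_iff) linarith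
  have w: "norm w < 1" unfolding w_def by (rule norm_of_real_powr_less_1[OF assms])
  note split = qpoch_inf_split[OF assms(1,2) w, of m]
  have nz: "qpoch_inf q w \<noteq> 0" by (rule qpoch_inf_nonzero[OF assms(1,2) w])
  have shift: "of_real q powr (z + of_nat m) = w * of_real q ^ m"
    using assms powr_mult_of_nat[of "of_real q" 1 m] by (simp add: powr_add w_def)
  have "p powr (1 - (z + of_nat m)) = p powr (1 - z) / p ^ m"
    using p powr_diff[of p "1 - z" "of_nat m"] powr_mult_of_nat[of p 1 m]
    by (simp add: algebra_simps)
  thus ?thesis
    using split nz p unfolding q_Gamma_def p_def[symmetric] shift w_def[symmetric]
    by (simp add: field_simps)
qed

text \<open>
  The common factor \<open>q_Gamma q (c - \<sigma>)\<close> of the two beta functions cancels, and the symbol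
  \<open>(q^c;q)_m\<close> is what the shift from \<open>c\<close> to \<open>c + m\<close> leaves in the denominator.
\<close>
lemma q_Beta_quotient:
  assumes "0 < q" "q < 1" "Re \<sigma> > 0" "Re c > Re \<sigma>"
  shows "q_Beta q (\<sigma> + of_nat m) (c - \<sigma>) / q_Beta q \<sigma> (c - \<sigma>) * qpoch q (of_real q powr c) m
    = qpoch q (of_real q powr \<sigma>) m"
proof -
  have nz: "q_Gamma q \<sigma> \<noteq> 0" "q_Gamma q c \<noteq> 0" "q_Gamma q (c - \<sigma>) \<noteq> 0"
    using q_Gamma_nonzero[OF assms(1,2)] assms(3,4) by auto
  have p: "complex_of_real (1 - q) \<noteq> 0"
    using assms by (subst of_real_eq_0_iff) linarith
  have "qpoch q (of_real q powr c) m \<noteq> 0"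
    using qpoch_factor_nonzero[OF assms(1,2) norm_of_real_powr_less_1] assms
    by (simp add: qpoch_def del: right_minus_eq)
  moreover have "\<sigma> + of_nat m + (c - \<sigma>) = c + of_nat m" by simp
  ultimately show ?thesis
    using nz p assms
    by (simp add: q_Beta_def q_Gamma_add_of_nat field_simps del: of_real_diff)
qed

text \<open>
  The quotient \<open>(q^\<sigma>;q)_m / (q;q)_m\<close> is bounded in \<open>m\<close>, and so is the infinite product in the
  reciprocal \<open>q\<close>-gamma function, because \<open>q powr (\<eta> m + \<kappa>)\<close> lies in the unit disc. What is
  left is the power of \<open>1 - q\<close>.
\<close>
lemma q_mittag_leffler_coefficient_bound:
  assumes "0 < q" "q < 1" "Re \<eta> > 0" "Re \<kappa> > 0" "Re \<sigma> > 0" "Re c > Re \<sigma>"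
  obtains C where
    "\<And>m. norm (q_mittag_leffler_term q \<eta> \<kappa> \<sigma> c 1 m) \<le> C * ((1 - q) powr Re \<eta>) ^ m"
proof -
  obtain D where D: "D > 0"
      "\<And>m. norm (qpoch q (of_real q powr \<sigma>) m / qpoch q (of_real q) m) \<le> D"
    using qpoch_quotient_bounded[OF assms(1,2)] by metis
  define K where
    "K = exp (1 / (1 - q)) / norm (qpoch_inf q (of_real q)) * (1 - q) powr (Re \<kappa> - 1)"
  have Gamma_bound: "norm (inverse (q_Gamma q (\<eta> * of_nat m + \<kappa>))) \<le> K * ((1 - q) powr Re \<eta>) ^ m" for m
  proof -
    have "Re (\<eta> * of_nat m + \<kappa>) > 0"
      using assms by (simp add: add_nonneg_pos)
    hence "norm (qpoch_inf q (of_real q powr (\<eta> * of_nat m + \<kappa>))) \<le> exp (1 / (1 - q))"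
      using assms by (intro norm_qpoch_inf_le less_imp_le[OF norm_of_real_powr_less_1])
    moreover have "norm (of_real (1 - q) powr (\<eta> * of_nat m + \<kappa> - 1) :: complex)
        = (1 - q) powr (Re \<kappa> - 1) * ((1 - q) powr Re \<eta>) ^ m"
    proof -
      have "norm (of_real (1 - q) powr (\<eta> * of_nat m + \<kappa> - 1) :: complex)
          = (1 - q) powr ((Re \<kappa> - 1) + real m * Re \<eta>)"
        using assms by (subst norm_of_real_powr) (simp_all add: algebra_simps)
      thus ?thesis using assms by (simp add: powr_add powr_power mult_ac)
    qed
    ultimately show ?thesis
      unfolding inverse_q_Gamma[OF assms(1,2)] K_def norm_mult norm_divide
      by (simp add: divide_right_mono mult_right_mono mult.assoc)
  qed
  have "norm (q_mittag_leffler_term q \<eta> \<kappa> \<sigma> c 1 m) \<le> (D * K) * ((1 - q) powr Re \<eta>) ^ m" for m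
  proof -
    have "q_mittag_leffler_term q \<eta> \<kappa> \<sigma> c 1 m
        = q_Beta q (\<sigma> + of_nat m) (c - \<sigma>) / q_Beta q \<sigma> (c - \<sigma>) * qpoch q (of_real q powr c) m
          / qpoch q (of_real q) m * inverse (q_Gamma q (\<eta> * of_nat m + \<kappa>))"
      by (simp add: q_mittag_leffler_term_def divide_inverse mult_ac)
    also have "\<dots> = qpoch q (of_real q powr \<sigma>) m / qpoch q (of_real q) m
        * inverse (q_Gamma q (\<eta> * of_nat m + \<kappa>))"
      using assms by (subst q_Beta_quotient) auto
    finally show ?thesis
      using mult_mono[OF D(2)[of m] Gamma_bound[of m]] D(1)
      by (simp only: norm_mult mult.assoc norm_ge_zero less_imp_le)
  qed
  thus ?thesis by (rule that)
qed

section \<open>Term-by-term transformation of a power series\<close>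

lemma suminf_swap_product_majorant:
  fixes f :: "nat \<Rightarrow> nat \<Rightarrow> 'a :: banach"
  assumes "summable a" "summable b" "\<And>i. a i \<ge> 0" "\<And>i. b i \<ge> 0"
    and bound: "\<And>j m. norm (f j m) \<le> a j * b m"
  shows "summable (\<lambda>j. \<Sum>m. f j m)" "summable (\<lambda>m. \<Sum>j. f j m)"
    "(\<Sum>j. \<Sum>m. f j m) = (\<Sum>m. \<Sum>j. f j m)"
proof -
  have rows: "summable (\<lambda>m. norm (f j m))" for j
    using bound by (intro summable_comparison_test'[OF summable_mult[OF assms(2), of "a j"]]) auto
  have cols: "summable (\<lambda>j. norm (f j m))" for m
    using bound by (intro summable_comparison_test'[OF summable_mult2[OF assms(1), of "b m"]]) auto
  have infsum: "infsum g UNIV = suminf g" if "summable (\<lambda>n. norm (g n))" for g :: "nat \<Rightarrow> 'a"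
    using norm_summable_imp_has_sum[OF that summable_sums[OF summable_norm_cancel[OF that]]]
    by (rule infsumI)
  have "norm (\<Sum>m. f j m) \<le> a j * suminf b" for j
    using norm_suminf_le[OF bound summable_mult[OF assms(2)], of j]
      suminf_mult[OF assms(2), of "a j"] by simp
  hence row_sums: "summable (\<lambda>j. norm (\<Sum>m. f j m))"
    by (intro summable_comparison_test'[OF summable_mult2[OF assms(1), of "suminf b"]]) auto
  have "norm (\<Sum>j. f j m) \<le> suminf a * b m" for m
    using norm_suminf_le[OF bound summable_mult2[OF assms(1)], of m]
      suminf_mult2[OF assms(1), of "b m"] by simp
  hence col_sums: "summable (\<lambda>m. norm (\<Sum>j. f j m))"
    by (intro summable_comparison_test'[OF summable_mult[OF assms(2), of "suminf a"]]) auto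
  have "(\<lambda>(j, m). a j * b m) summable_on UNIV \<times> UNIV"
  proof (rule summable_on_SigmaI)
    show "((\<lambda>m. case (j, m) of (j, m) \<Rightarrow> a j * b m) has_sum a j * suminf b) UNIV" for j
      using assms(2-4)
      by (auto intro!: sums_nonneg_imp_has_sum sums_mult summable_sums)
    show "(\<lambda>j. a j * suminf b) summable_on UNIV"
      using assms(1-4)
      by (intro norm_summable_imp_summable_on)
        (auto simp: abs_mult suminf_nonneg intro!: summable_mult2)
  qed (use assms(3,4) in auto)
  hence "(\<lambda>p. norm (case p of (j, m) \<Rightarrow> f j m)) summable_on UNIV \<times> UNIV"
    by (rule Infinite_Sum.abs_summable_on_comparison_test') (use bound in auto)
  hence "(\<lambda>(j, m). f j m) summable_on UNIV \<times> UNIV"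
    by (rule abs_summable_summable)
  hence "infsum (\<lambda>j. infsum (\<lambda>m. f j m) UNIV) UNIV = infsum (\<lambda>m. infsum (\<lambda>j. f j m) UNIV) UNIV"
    by (rule infsum_swap_banach)
  thus "(\<Sum>j. \<Sum>m. f j m) = (\<Sum>m. \<Sum>j. f j m)"
    by (simp add: infsum rows cols row_sums col_sums)
  show "summable (\<lambda>j. \<Sum>m. f j m)" "summable (\<lambda>m. \<Sum>j. f j m)"
    using row_sums col_sums by (blast intro: summable_norm_cancel)+
qed

text \<open>
  Euler's identity at \<open>z = q powr (1 + \<rho> m)\<close> shows that the transform sends \<open>u powr (\<rho> m)\<close> to
  \<open>q_Gamma q (1 + \<rho> m) * (1 - q) powr (\<rho> m) / s powr (\<rho> m + 1)\<close>. Summation over \<open>m\<close> may be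
  exchanged with the transform because \<open>q powr \<rho>\<close> lies in the unit disc: the double series is
  dominated by the product of the weights \<open>q^j / (q;q)_j\<close> and the terms at \<open>u = 1 / s\<close>.
\<close>
lemma q_laplace_powr_series:
  fixes A :: "nat \<Rightarrow> complex"
  assumes q: "0 < q" "q < 1" and \<rho>: "Re \<rho> > 0" and s: "Re s > 0"
    and A: "summable (\<lambda>m. norm (A m * (x * s powr (- \<rho>)) ^ m))"
  defines "f \<equiv> \<lambda>u. \<Sum>m. A m * (x * u powr \<rho>) ^ m"
    and "B \<equiv> \<lambda>m. A m * q_Gamma q (1 + \<rho> * of_nat m)
                 * (of_real (1 - q) powr \<rho> * x / s powr \<rho>) ^ m"
  shows "summable (\<lambda>m. A m * (x * (inverse s * of_real q ^ j) powr \<rho>) ^ m)"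
    and "q_laplace_converges q s f" and "summable B" and "q_laplace q s f = 1 / s * suminf B"
proof -
  have s0: "s \<noteq> 0" using s by auto
  define w where "w = (of_real q :: complex) powr \<rho>"
  define y where "y = x * s powr (- \<rho>)"
  define Q where "Q = qpoch_inf q (of_real q)"
  have Q: "Q \<noteq> 0" unfolding Q_def using q by (intro qpoch_inf_nonzero) auto
  have w: "norm w < 1" unfolding w_def by (rule norm_of_real_powr_less_1[OF q \<rho>])
  have node: "x * (inverse s * of_real q ^ j) powr \<rho> = y * w ^ j" for j
    using powr_jackson_node[OF q(1) s] by (simp add: y_def w_def)
  have term_le: "norm (A m * (y * w ^ j) ^ m) \<le> norm (A m * y ^ m)" for j m
  proof -
    have "norm (w ^ j) ^ m \<le> 1"
      using w by (intro power_le_one) (auto simp: norm_power power_le_one)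
    hence "norm (A m * y ^ m) * norm (w ^ j) ^ m \<le> norm (A m * y ^ m) * 1"
      by (intro mult_left_mono) auto
    thus ?thesis by (simp add: norm_mult norm_power power_mult_distrib mult.assoc)
  qed
  have inner: "summable (\<lambda>m. A m * (y * w ^ j) ^ m)" for j
    by (rule summable_comparison_test'[OF A[folded y_def]]) (rule term_le)
  thus "summable (\<lambda>m. A m * (x * (inverse s * of_real q ^ j) powr \<rho>) ^ m)"
    by (simp add: node)

  define F where
    "F = (\<lambda>j m. of_real q ^ j / qpoch q (of_real q) j * (A m * (y * w ^ j) ^ m))"
  \<comment> \<open>since \<open>(0;q)_j = 1\<close>, this bounds \<open>1 / (q;q)_j\<close>\<close>
  obtain D where D: "D > 0" "\<And>j. norm (qpoch q 0 j / qpoch q (of_real q) j) \<le> D"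
    using qpoch_quotient_bounded[OF q] by metis
  have "norm (of_real q ^ j / qpoch q (of_real q) j) \<le> D * q ^ j" for j
    using mult_right_mono[OF D(2)[of j], of "q ^ j"] q
    by (simp add: qpoch_def norm_divide norm_power)
  hence "norm (F j m) \<le> (D * q ^ j) * norm (A m * y ^ m)" for j m
    unfolding F_def norm_mult[of "of_real q ^ j / _"]
    using D(1) q by (intro mult_mono term_le) auto
  moreover have "summable (\<lambda>j. D * q ^ j)"
    using q by (intro summable_mult summable_geometric) auto
  ultimately have swap: "summable (\<lambda>j. \<Sum>m. F j m)" "summable (\<lambda>m. \<Sum>j. F j m)"
      "(\<Sum>j. \<Sum>m. F j m) = (\<Sum>m. \<Sum>j. F j m)"
    using suminf_swap_product_majorant[of "\<lambda>j. D * q ^ j" "\<lambda>m. norm (A m * y ^ m)" F]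
      A[folded y_def] D(1) q by auto

  have rows: "(\<Sum>m. F j m)
      = of_real q ^ j * f (inverse s * of_real q ^ j) / qpoch q (of_real q) j" for j
    unfolding F_def f_def node
    using suminf_mult[OF inner[of j], of "of_real q ^ j / qpoch q (of_real q) j"] by simp

  have cols: "Q * (\<Sum>j. F j m) = B m" for m
  proof -
    define z where "z = of_real q powr (1 + \<rho> * of_nat m)"
    define p where "p = complex_of_real (1 - q)"
    have p: "p \<noteq> 0" using q unfolding p_def by (subst of_real_eq_0_iff) linarith
    have "z = of_real q * w ^ m"
      using q by (simp add: z_def w_def powr_add powr_mult_of_nat)
    hence "F j m = A m * y ^ m * (z ^ j / qpoch q (of_real q) j)" for j
      by (simp add: F_def power_mult_distrib power_mult[symmetric] mult.commute mult.left_commute)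
    moreover have "(\<lambda>j. z ^ j / qpoch q (of_real q) j) sums (1 / qpoch_inf q z)"
      unfolding z_def using q \<rho>
      by (intro euler_q_exponential norm_of_real_powr_less_1) (auto simp: add_pos_nonneg)
    ultimately have "(\<lambda>j. F j m) sums (A m * y ^ m * (1 / qpoch_inf q z))"
      by (simp only: sums_mult)
    hence "Q * (\<Sum>j. F j m) = A m * y ^ m * (Q / qpoch_inf q z)"
      by (simp add: sums_iff)
    also have "Q / qpoch_inf q z = q_Gamma q (1 + \<rho> * of_nat m) * (p powr \<rho>) ^ m"
      using p powr_minus[of p "\<rho> * of_nat m"] powr_mult_of_nat[OF p, of \<rho> m]
      by (simp add: q_Gamma_def Q_def z_def p_def[symmetric] field_simps del: of_real_diff)
    finally show ?thesis
      unfolding B_def y_def p_def[symmetric]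
      by (simp add: powr_minus power_mult_distrib divide_inverse mult_ac)
  qed

  show conv: "q_laplace_converges q s f"
    using swap(1) unfolding rows q_laplace_converges_iff[OF q s0] .
  show "summable B"
    using summable_mult[OF swap(2), of Q] unfolding cols .
  have "q_laplace q s f = Q / s * (\<Sum>m. \<Sum>j. F j m)"
    unfolding q_laplace_eq_suminf[OF q s0 conv] rows[symmetric] swap(3) Q_def ..
  also have "\<dots> = 1 / s * (\<Sum>m. Q * (\<Sum>j. F j m))"
    using suminf_mult[OF swap(2), of Q] by simp
  finally show "q_laplace q s f = 1 / s * suminf B" unfolding cols .
qed

section \<open>The transform of the extended \<open>q\<close>-Mittag-Leffler function\<close>

theorem theorem6p4:
  fixes q :: real and \<eta> \<kappa> \<sigma> c \<rho> s x :: complex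
  assumes "0 < q" and "q < 1"
    and "Re \<eta> > 0" and "Re \<kappa> > 0" and "Re \<rho> > 0" and "Re s > 0"
    and "Re c > Re \<sigma>" and "Re \<sigma> > 0"
    and "norm (x * s powr (- \<rho>)) < (1 - q) powr (- Re \<eta>)"
  shows "(\<forall>j. summable (q_mittag_leffler_term q \<eta> \<kappa> \<sigma> c
               (x * (inverse s * of_real q ^ j) powr \<rho>)))
       \<and> q_laplace_converges q s (\<lambda>u. q_mittag_leffler q \<eta> \<kappa> \<sigma> c (x * u powr \<rho>))
       \<and> summable (\<lambda>m. q_Beta q (\<sigma> + of_nat m) (c - \<sigma>) * qpoch q (of_real q powr c) m
               / (q_Beta q \<sigma> (c - \<sigma>) * qpoch q (of_real q) m)
               * (q_Gamma q (1 + \<rho> * of_nat m) / q_Gamma q (\<eta> * of_nat m + \<kappa>))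
               * (of_real (1 - q) powr \<rho> * x / s powr \<rho>) ^ m)
       \<and> q_laplace q s (\<lambda>u. q_mittag_leffler q \<eta> \<kappa> \<sigma> c (x * u powr \<rho>))
         = 1 / s * (\<Sum>m. q_Beta q (\<sigma> + of_nat m) (c - \<sigma>) * qpoch q (of_real q powr c) m
               / (q_Beta q \<sigma> (c - \<sigma>) * qpoch q (of_real q) m)
               * (q_Gamma q (1 + \<rho> * of_nat m) / q_Gamma q (\<eta> * of_nat m + \<kappa>))
               * (of_real (1 - q) powr \<rho> * x / s powr \<rho>) ^ m)"
proof -
  define A where "A = (\<lambda>m. q_mittag_leffler_term q \<eta> \<kappa> \<sigma> c 1 m)"
  have expand: "q_mittag_leffler_term q \<eta> \<kappa> \<sigma> c u m = A m * u ^ m" for u m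
    by (simp add: A_def q_mittag_leffler_term_def)
  define y where "y = x * s powr (- \<rho>)"
  define r where "r = (1 - q) powr Re \<eta> * norm y"
  obtain C where C: "norm (A m) \<le> C * ((1 - q) powr Re \<eta>) ^ m" for m
    unfolding A_def using q_mittag_leffler_coefficient_bound assms(1-4,7,8) by metis
  have "r < (1 - q) powr Re \<eta> * (1 - q) powr (- Re \<eta>)"
    unfolding r_def y_def using assms(2,9) by (intro mult_strict_left_mono) auto
  hence r: "0 \<le> r" "r < 1"
    using assms(2) by (simp_all add: r_def powr_add[symmetric])
  have "summable (\<lambda>m. norm (A m * y ^ m))"
  proof (rule summable_comparison_test')
    show "summable (\<lambda>m. C * r ^ m)" using r by (intro summable_mult summable_geometric) auto
    show "norm (norm (A m * y ^ m)) \<le> C * r ^ m" for m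
      using mult_right_mono[OF C[of m], of "norm y ^ m"]
      by (simp add: norm_mult norm_power r_def power_mult_distrib mult_ac)
  qed
  note laplace = q_laplace_powr_series[OF assms(1,2,5,6) this[unfolded y_def]]
  have coeff: "q_Beta q (\<sigma> + of_nat m) (c - \<sigma>) * qpoch q (of_real q powr c) m
               / (q_Beta q \<sigma> (c - \<sigma>) * qpoch q (of_real q) m)
               * (q_Gamma q (1 + \<rho> * of_nat m) / q_Gamma q (\<eta> * of_nat m + \<kappa>))
      = A m * q_Gamma q (1 + \<rho> * of_nat m)" for m
    by (simp add: A_def q_mittag_leffler_term_def)
  show ?thesis
    unfolding coeff q_mittag_leffler_def expand by (intro conjI allI laplace)
qed

end
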